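(* Let $X$ be a real Hilbert space, $m\in\mathbb{N}$, $I:=\{1,\ldots,m\}$, let $T_i:X\to X$, $i\in I$, be cutters with fixed point sets $F_i:=\mathrm{Fix}(T_i)$, and let $w:I\to(0,1]$ be a positive weight function. If $\bigcap_{i\in I}F_i\neq\emptyset$ and $x\in X$ satisfies $x\notin\bigcap_{i\in I}F_i$, then $T_w(x)\neq x$ and $\mathbf{P}_{\mathbf{D}}(\mathbf{T}(\mathbf{x}))\neq\mathbf{x}$, where $\mathbf{x}:=\mathbf{J}(x)$.
   Context: An operator $T:X\to X$ on a real Hilbert space is called a cutter if $\mathrm{Fix}(T):=\{x\in X\mid T(x)=x\}\neq\emptyset$ and $\langle x-T(x),q-T(x)\rangle\le 0$ for all $x\in X$ and all $q\in\mathrm{Fix}(T)$. A positive weight function is a function $w:I\to(0,1]$ with $\sum_{i\in I}w(i)=1$. Put $T_w(x):=\sum_{i\in I}w(i)T_i(x)$. The product space is $\mathbf{X}:=X^m$ with inner product $\langle\langle\mathbf{x},\mathbf{y}\rangle\rangle_w:=\sum_{i=1}^m w(i)\langle x^i,y^i\rangle$ for $\mathbf{x}=(x^1,\ldots,x^m)$, $\mathbf{y}=(y^1,\ldots,y^m)$. The diagonal set is $\mathbf{D}:=\{(x,x,\ldots,x)\in\mathbf{X}\mid x\in X\}$ (a closed linear subspace), $\mathbf{J}:X\to\mathbf{D}$ is $\mathbf{J}(x):=(x,x,\ldots,x)$, $\mathbf{T}:\mathbf{X}\to\mathbf{X}$ is $\mathbf{T}(\mathbf{x}):=(T_1(x^1),\ldots,T_m(x^m))$,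 and $\mathbf{P}_{\mathbf{D}}$ is the orthogonal projection of $\mathbf{X}$ onto $\mathbf{D}$ with respect to $\langle\langle\cdot,\cdot\rangle\rangle_w$. *)

theory Defs
  imports "HOL-Analysis.Analysis"
begin

definition Fix :: "('a \<Rightarrow> 'a) \<Rightarrow> 'a set" where
  "Fix T = {x. T x = x}"

definition cutter :: "('a::real_inner \<Rightarrow> 'a) \<Rightarrow> bool" where
  "cutter T \<longleftrightarrow> Fix T \<noteq> {} \<and> (\<forall>x. \<forall>q\<in>Fix T. (x - T x) \<bullet> (q - T x) \<le> 0)"

definition positive_weight :: "('m::finite \<Rightarrow> real) \<Rightarrow> bool" where
  "positive_weight w \<longleftrightarrow> (\<forall>i. w i \<in> {0<..1}) \<and> (\<Sum>i\<in>UNIV. w i) = 1"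

definition weighted_op :: "('m::finite \<Rightarrow> real) \<Rightarrow> ('m \<Rightarrow> 'a \<Rightarrow> 'a) \<Rightarrow> 'a \<Rightarrow> 'a::real_vector" where
  "weighted_op w T x = (\<Sum>i\<in>UNIV. w i *\<^sub>R T i x)"

(* The product space X^m is the type 'a ^ 'm, where the finite index type 'm plays the role of
   {1,...,m}. The library equips this type with the unweighted inner product (all weights 1),
   so the weighted one is a separate function and orthogonality below refers to it only. *)

definition weighted_inner :: "('m::finite \<Rightarrow> real) \<Rightarrow> ('a::real_inner) ^ 'm \<Rightarrow> 'a ^ 'm \<Rightarrow> real" where
  "weighted_inner w x y = (\<Sum>i\<in>UNIV. w i * ((x $ i) \<bullet> (y $ i)))"

definition diag_embed :: "'a \<Rightarrow> 'a ^ 'm::finite" where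
  "diag_embed x = (\<chi> i. x)"

definition diagonal :: "('a ^ 'm::finite) set" where
  "diagonal = range diag_embed"

definition product_op :: "('m::finite \<Rightarrow> 'a \<Rightarrow> 'a) \<Rightarrow> 'a ^ 'm \<Rightarrow> 'a ^ 'm" where
  "product_op T x = (\<chi> i. T i (x $ i))"

(* Orthogonal projection of x onto a linear subspace S with respect to an inner product ip:
   the y in S such that x - y is ip-orthogonal to S. It is unique whenever ip is positive
   definite, and exists whenever S is complete for ip. *)
definition orth_proj :: "('v \<Rightarrow> 'v \<Rightarrow> real) \<Rightarrow> 'v set \<Rightarrow> 'v \<Rightarrow> 'v::real_vector" where
  "orth_proj ip S x = (THE y. y \<in> S \<and> (\<forall>z\<in>S. ip (x - y) z = 0))"

end

theory Submission
  imports Defs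
begin

text \<open>For a cutter \<open>S\<close> and \<open>q \<in> Fix S\<close>, the displacement \<open>S x - x\<close> makes an acute angle with the
  direction \<open>q - x\<close>, quantitatively \<open>\<parallel>S x - x\<parallel>\<^sup>2 \<le> (S x - x) \<bullet> (q - x)\<close>
  (\<open>cutter_displacement\<close>). When \<open>q\<close> is a common fixed point of all \<open>T i\<close>, every displacement
  therefore points towards the same \<open>q\<close>, so the displacements cannot cancel in the weighted
  average: \<open>(weighted_op w T x - x) \<bullet> (q - x)\<close> is at least the weighted sum of the
  \<open>\<parallel>T i x - x\<parallel>\<^sup>2\<close>, which is positive as soon as one \<open>T i\<close> moves \<open>x\<close>.

  The assertion in the product space is the same one. The weighted projection onto the diagonal
  averages the components (\<open>orth_proj_diagonal\<close>), so it sends the image of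
  \<open>diag_embed x\<close> under the product operator to \<open>diag_embed (weighted_op w T x)\<close>, and
  \<open>diag_embed\<close> is injective.\<close>

lemma cutter_displacement:
  assumes "cutter S" "q \<in> Fix S"
  shows "(norm (S x - x))\<^sup>2 \<le> (S x - x) \<bullet> (q - x)"
proof -
  have "(x - S x) \<bullet> (q - S x) \<le> 0"
    using assms by (simp add: cutter_def)
  moreover have "(x - S x) \<bullet> (q - S x) = (norm (S x - x))\<^sup>2 - (S x - x) \<bullet> (q - x)"
    by (simp add: power2_norm_eq_inner inner_diff_left inner_diff_right inner_commute)
  ultimately show ?thesis by simp
qed

lemma weighted_op_minus:
  assumes "positive_weight w"
  shows "weighted_op w T x - x = (\<Sum>i\<in>UNIV. w i *\<^sub>R (T i x - x))"
  using assms
  by (simp add: weighted_op_def positive_weight_def scaleR_diff_right sum_subtractf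
      flip: scaleR_left.sum)

lemma weighted_op_moves_non_common_fixed_points:
  assumes cut: "\<And>i. cutter (T i)" and w: "positive_weight w"
    and ne: "(\<Inter>i. Fix (T i)) \<noteq> {}" and x: "x \<notin> (\<Inter>i. Fix (T i))"
  shows "weighted_op w T x \<noteq> x"
proof
  assume fixed: "weighted_op w T x = x"
  obtain q where q: "\<And>i. q \<in> Fix (T i)" using ne by auto
  obtain j where j: "T j x \<noteq> x" using x by (auto simp: Fix_def)
  have wpos: "w i > 0" for i using w by (simp add: positive_weight_def)
  have "0 < (\<Sum>i\<in>UNIV. w i * (norm (T i x - x))\<^sup>2)"
    using j wpos by (intro sum_pos2[where i = j]) (auto simp: less_imp_le)
  also have "\<dots> \<le> (\<Sum>i\<in>UNIV. w i * ((T i x - x) \<bullet> (q - x)))"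
    using cutter_displacement[OF cut q] wpos
    by (intro sum_mono mult_left_mono) (auto simp: less_imp_le)
  also have "\<dots> = (weighted_op w T x - x) \<bullet> (q - x)"
    by (simp add: weighted_op_minus[OF w] inner_sum_left)
  finally show False using fixed by simp
qed

text \<open>Pairing with a diagonal vector only sees the weighted average of the components; hence
  a diagonal vector is the projection of \<open>y\<close> exactly if its entry is the average of \<open>y\<close>.\<close>

lemma weighted_inner_diag_embed:
  assumes "positive_weight w"
  shows "weighted_inner w (y - diag_embed a) (diag_embed z) = ((\<Sum>i\<in>UNIV. w i *\<^sub>R y $ i) - a) \<bullet> z"
  using assms
  by (simp add: weighted_inner_def diag_embed_def positive_weight_def inner_diff_left
      right_diff_distrib sum_subtractf inner_sum_left flip: sum_distrib_right)

lemma orth_proj_diagonal: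
  assumes "positive_weight w"
  shows "orth_proj (weighted_inner w) diagonal y = diag_embed (\<Sum>i\<in>UNIV. w i *\<^sub>R y $ i)"
  unfolding orth_proj_def diagonal_def
proof (rule the_equality)
  let ?s = "\<Sum>i\<in>UNIV. w i *\<^sub>R y $ i"
  show "diag_embed ?s \<in> range diag_embed \<and>
      (\<forall>z\<in>range diag_embed. weighted_inner w (y - diag_embed ?s) z = 0)"
    by (auto simp: weighted_inner_diag_embed[OF assms])
  fix v assume "v \<in> range diag_embed \<and>
      (\<forall>z\<in>range diag_embed. weighted_inner w (y - v) z = 0)"
  then obtain a where v: "v = diag_embed a" and orth: "\<And>z. (?s - a) \<bullet> z = 0"
    by (auto simp: weighted_inner_diag_embed[OF assms])
  from orth[of "?s - a"] show "v = diag_embed ?s" by (simp add: v)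
qed

lemma diag_embed_eq_iff: "diag_embed a = diag_embed b \<longleftrightarrow> a = b"
  by (simp add: diag_embed_def vec_eq_iff)

theorem proposition3p4:
  fixes T :: "'m::finite \<Rightarrow> 'a::{real_inner, complete_space} \<Rightarrow> 'a"
    and w :: "'m \<Rightarrow> real"
    and x :: 'a
  assumes "\<And>i. cutter (T i)"
    and "positive_weight w"
    and "(\<Inter>i. Fix (T i)) \<noteq> {}"
    and "x \<notin> (\<Inter>i. Fix (T i))"
  shows "weighted_op w T x \<noteq> x \<and>
    orth_proj (weighted_inner w) diagonal (product_op T (diag_embed x)) \<noteq> diag_embed x"
proof -
  have "orth_proj (weighted_inner w) diagonal (product_op T (diag_embed x))
      = diag_embed (weighted_op w T x)"
    by (simp add: orth_proj_diagonal[OF assms(2)] product_op_def diag_embed_def weighted_op_def)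
  with weighted_op_moves_non_common_fixed_points[OF assms] show ?thesis
    by (simp add: diag_embed_eq_iff)
qed

end
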